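(* The following is a complete list of the one-dimensional real Lie subalgebras of $\mathfrak{sl}_3(\mathbb{R})$ up to conjugation in $\mathrm{SL}_3(\mathbb{R})$: (1) $\mathfrak{u}_{1,1}=\langle X_\alpha+X_\beta\rangle$; (2) $\mathfrak{u}_{1,2}=\langle X_\alpha\rangle$; (3) $\mathfrak{u}_{1,3}=\langle X_\alpha+H_\alpha+2H_\beta\rangle$; (4) $\mathfrak{u}_{1,4}^a=\langle H_\alpha+aH_\beta\rangle$, $a\in\mathbb{R}$, $a\neq 0,1$, where $\mathfrak{u}_{1,4}^a\sim\mathfrak{u}_{1,4}^b$ if and only if $b\in\{a,\,1-a,\,\frac1a,\,\frac1{1-a},\,\frac{a}{a-1},\,\frac{a-1}{a}\}$ (equivalently, for $a,b\in[\frac12,1)$ one has $\mathfrak{u}_{1,4}^a\sim\mathfrak{u}_{1,4}^b$ iff $a=b$, and for every $c\in\mathbb{R}\setminus\{0,1\}$ one has $\mathfrak{u}_{1,4}^c\sim\mathfrak{u}_{1,4}^a$ for some $a\in[\frac12,1)$); (5) $\mathfrak{u}_{1,5}=\langle H_\alpha+H_\beta\rangle$; (6) $\mathfrak{u}_{1,6}=\langle -X_{\alpha+\beta}+Y_{\alpha+\beta}\rangle$; (7) $\mathfrak{u}_{1,7}^y=\langle H_\alpha+\frac12H_\beta-yX_\beta+yY_\beta\rangle$, $y\in\mathbb{R}\setminus\{0\}$, where $\mathfrak{u}_{1,7}^y\sim\mathfrak{u}_{1,7}^{y'}$ if and only if $y=\pm y'$. That is, every one-dimensional real subalgebra of $\mathfrak{sl}_3(\mathbb{R})$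 is conjugate under $\mathrm{SL}_3(\mathbb{R})$ to a subalgebra in this list, and subalgebras in the list are pairwise non-conjugate under $\mathrm{SL}_3(\mathbb{R})$ except for the conjugacies within the families (4) and (7) indicated above.
   Context: $\mathfrak{sl}_3(\mathbb{R})$ is the Lie algebra of traceless real $3\times3$ matrices and $\mathrm{SL}_3(\mathbb{R})$ acts on its subalgebras by $g\cdot\mathfrak{u}=g\mathfrak{u}g^{-1}$; $\mathfrak{u}\sim\mathfrak{v}$ means that $\mathfrak{u}$ and $\mathfrak{v}$ lie in the same orbit of this action. With $E_{ij}$ the matrix units, the basis of $\mathfrak{sl}_3(\mathbb{R})$ used is $H_\alpha=E_{11}-E_{22}$, $H_\beta=E_{22}-E_{33}$, $X_\alpha=E_{12}$, $X_\beta=E_{23}$, $X_{\alpha+\beta}=-E_{13}$, $Y_\alpha=E_{21}$, $Y_\beta=E_{32}$, $Y_{\alpha+\beta}=-E_{31}$. $\langle\cdots\rangle$ denotes the real linear span. *)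

theory Defs
  imports "HOL-Analysis.Analysis"
begin

definition sl3 :: "(real^3^3) set" where
  "sl3 = {A. trace A = 0}"

definition SL3 :: "(real^3^3) set" where
  "SL3 = {g. det g = 1}"

definition lie_bracket :: "real^3^3 \<Rightarrow> real^3^3 \<Rightarrow> real^3^3" where
  "lie_bracket A B = A ** B - B ** A"

definition lie_subalgebra_sl3 :: "(real^3^3) set \<Rightarrow> bool" where
  "lie_subalgebra_sl3 U \<longleftrightarrow>
     U \<subseteq> sl3 \<and> subspace U \<and> (\<forall>A\<in>U. \<forall>B\<in>U. lie_bracket A B \<in> U)"

definition conj_act :: "real^3^3 \<Rightarrow> (real^3^3) set \<Rightarrow> (real^3^3) set" where
  "conj_act g U = (\<lambda>A. g ** A ** matrix_inv g) ` U"

definition conjugate :: "(real^3^3) set \<Rightarrow> (real^3^3) set \<Rightarrow> bool" (infix "\<sim>" 50) where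
  "U \<sim> V \<longleftrightarrow> (\<exists>g\<in>SL3. V = conj_act g U)"

text \<open>In the index type the numeral 3 is identified with 0; 1, 2, 3 are its three elements.\<close>

definition E :: "3 \<Rightarrow> 3 \<Rightarrow> real^3^3" where
  "E i j = (\<chi> r c. if r = i \<and> c = j then 1 else 0)"

definition H_alpha :: "real^3^3" where "H_alpha = E 1 1 - E 2 2"
definition H_beta :: "real^3^3" where "H_beta = E 2 2 - E 3 3"
definition X_alpha :: "real^3^3" where "X_alpha = E 1 2"
definition X_beta :: "real^3^3" where "X_beta = E 2 3"
definition X_alpha_beta :: "real^3^3" where "X_alpha_beta = - E 1 3"
definition Y_alpha :: "real^3^3" where "Y_alpha = E 2 1"
definition Y_beta :: "real^3^3" where "Y_beta = E 3 2"
definition Y_alpha_beta :: "real^3^3" where "Y_alpha_beta = - E 3 1"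

definition u11 :: "(real^3^3) set" where "u11 = span {X_alpha + X_beta}"
definition u12 :: "(real^3^3) set" where "u12 = span {X_alpha}"
definition u13 :: "(real^3^3) set" where "u13 = span {X_alpha + H_alpha + 2 *\<^sub>R H_beta}"
definition u14 :: "real \<Rightarrow> (real^3^3) set" where "u14 a = span {H_alpha + a *\<^sub>R H_beta}"
definition u15 :: "(real^3^3) set" where "u15 = span {H_alpha + H_beta}"
definition u16 :: "(real^3^3) set" where "u16 = span {- X_alpha_beta + Y_alpha_beta}"
definition u17 :: "real \<Rightarrow> (real^3^3) set" where
  "u17 y = span {H_alpha + (1/2) *\<^sub>R H_beta - y *\<^sub>R X_beta + y *\<^sub>R Y_beta}"

text \<open>Subalgebras are grouped by item of the classification, so that members of different
  groups are claimed non-conjugate, and each parametrised family has its own criterion.\<close>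

definition families :: "(real^3^3) set set list" where
  "families =
     [{u11}, {u12}, {u13}, {u14 a | a. a \<noteq> 0 \<and> a \<noteq> 1}, {u15}, {u16}, {u17 y | y. y \<noteq> 0}]"

end

(* Up to the choice of a spanning matrix, the conjugacy classes of lines in sl_3(R) are the similarity
   classes of nonzero traceless matrices modulo nonzero scalars. The list consists of the
   real Jordan forms, obtained by splitting off a real eigenvector of A and then triangularising
   or rotating the remaining 2x2 block. Under A -> k A the invariants tr(A^2) and det A are multiplied
   by k^2 and k^3. Together with the degree of the minimal polynomial they separate the
   items of the list, and within the two families they give the stated parameter relations: for
   diag(1, a - 1, -a) the quantity tr(A^2)^3 / det(A)^2 is, up to a factor, the j-invariant of a. *)

theory Submission
  imports Defs
begin

section \<open>Coordinates for real 3x3 matrices\<close>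

text \<open>With nine explicit entries and simp rules for the operations, a matrix identity becomes
  nine scalar equations.\<close>

definition mat3 :: "real \<Rightarrow> real \<Rightarrow> real \<Rightarrow> real \<Rightarrow> real \<Rightarrow> real \<Rightarrow> real \<Rightarrow> real \<Rightarrow> real \<Rightarrow> real^3^3" where
  "mat3 a b c d e f g h i =
     vector [vector [a, b, c], vector [d, e, f], vector [g, h, i]]"

lemma mat3_nth [simp]:
  "mat3 a b c d e f g h i $ 1 $ 1 = a" "mat3 a b c d e f g h i $ 1 $ 2 = b"
  "mat3 a b c d e f g h i $ 1 $ 3 = c" "mat3 a b c d e f g h i $ 2 $ 1 = d"
  "mat3 a b c d e f g h i $ 2 $ 2 = e" "mat3 a b c d e f g h i $ 2 $ 3 = f"
  "mat3 a b c d e f g h i $ 3 $ 1 = g" "mat3 a b c d e f g h i $ 3 $ 2 = h"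
  "mat3 a b c d e f g h i $ 3 $ 3 = i"
  by (simp_all add: mat3_def vector_3)

lemma mat3_collapse:
  "mat3 (A$1$1) (A$1$2) (A$1$3) (A$2$1) (A$2$2) (A$2$3) (A$3$1) (A$3$2) (A$3$3) = A"
  by (simp add: vec_eq_iff forall_3)

lemma mat3_cases:
  obtains a b c d e f g h i where "A = mat3 a b c d e f g h i"
  using mat3_collapse[of A] by metis

lemma mat3_eq_iff [simp]:
  "mat3 a b c d e f g h i = mat3 a' b' c' d' e' f' g' h' i' \<longleftrightarrow>
     a = a' \<and> b = b' \<and> c = c' \<and> d = d' \<and> e = e' \<and> f = f' \<and> g = g' \<and> h = h' \<and> i = i'"
  by (auto simp: vec_eq_iff forall_3)

lemma mat3_mult [simp]:
  "mat3 a b c d e f g h i ** mat3 a' b' c' d' e' f' g' h' i' =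
     mat3 (a*a' + b*d' + c*g') (a*b' + b*e' + c*h') (a*c' + b*f' + c*i')
          (d*a' + e*d' + f*g') (d*b' + e*e' + f*h') (d*c' + e*f' + f*i')
          (g*a' + h*d' + i*g') (g*b' + h*e' + i*h') (g*c' + h*f' + i*i')"
  by (simp add: vec_eq_iff forall_3 matrix_matrix_mult_def sum_3)

lemma mat3_add [simp]:
  "mat3 a b c d e f g h i + mat3 a' b' c' d' e' f' g' h' i' =
     mat3 (a + a') (b + b') (c + c') (d + d') (e + e') (f + f') (g + g') (h + h') (i + i')"
  by (simp add: vec_eq_iff forall_3)

lemma mat3_diff [simp]:
  "mat3 a b c d e f g h i - mat3 a' b' c' d' e' f' g' h' i' =
     mat3 (a - a') (b - b') (c - c') (d - d') (e - e') (f - f') (g - g') (h - h') (i - i')"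
  by (simp add: vec_eq_iff forall_3)

lemma mat3_uminus [simp]:
  "- mat3 a b c d e f g h i = mat3 (-a) (-b) (-c) (-d) (-e) (-f) (-g) (-h) (-i)"
  by (simp add: vec_eq_iff forall_3)

lemma mat3_scaleR [simp]:
  "k *\<^sub>R mat3 a b c d e f g h i =
     mat3 (k*a) (k*b) (k*c) (k*d) (k*e) (k*f) (k*g) (k*h) (k*i)"
  by (simp add: vec_eq_iff forall_3)

lemma zero_eq_mat3: "0 = mat3 0 0 0 0 0 0 0 0 0"
  by (simp add: vec_eq_iff forall_3)

lemma mat_eq_mat3: "mat k = mat3 k 0 0 0 k 0 0 0 k"
  by (simp add: vec_eq_iff forall_3 mat_def)

lemma det_mat3 [simp]:
  "det (mat3 a b c d e f g h i) = a*e*i + b*f*g + c*d*h - a*f*h - b*d*i - c*e*g"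
  by (simp add: det_3)

lemma trace_mat3 [simp]: "trace (mat3 a b c d e f g h i) = a + e + i"
  by (simp add: trace_def sum_3)

lemma E_eq_mat3:
  "E 1 1 = mat3 1 0 0 0 0 0 0 0 0" "E 1 2 = mat3 0 1 0 0 0 0 0 0 0"
  "E 1 3 = mat3 0 0 1 0 0 0 0 0 0" "E 2 1 = mat3 0 0 0 1 0 0 0 0 0"
  "E 2 2 = mat3 0 0 0 0 1 0 0 0 0" "E 2 3 = mat3 0 0 0 0 0 1 0 0 0"
  "E 3 1 = mat3 0 0 0 0 0 0 1 0 0" "E 3 2 = mat3 0 0 0 0 0 0 0 1 0"
  "E 3 3 = mat3 0 0 0 0 0 0 0 0 1"
  by (simp_all add: vec_eq_iff forall_3 E_def)

lemmas basis_defs = H_alpha_def H_beta_def X_alpha_def X_beta_def X_alpha_beta_def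
  Y_alpha_def Y_beta_def Y_alpha_beta_def

lemma u_eq_mat3:
  "u11 = span {mat3 0 1 0 0 0 1 0 0 0}"
  "u12 = span {mat3 0 1 0 0 0 0 0 0 0}"
  "u13 = span {mat3 1 1 0 0 1 0 0 0 (-2)}"
  "u14 a = span {mat3 1 0 0 0 (a - 1) 0 0 0 (- a)}"
  "u15 = span {mat3 1 0 0 0 0 0 0 0 (-1)}"
  "u16 = span {mat3 0 0 1 0 0 0 (-1) 0 0}"
  "u17 y = span {mat3 1 0 0 0 (-1/2) (-y) 0 y (-1/2)}"
  by (simp_all add: u11_def u12_def u13_def u14_def u15_def u16_def u17_def basis_defs E_eq_mat3)

section \<open>Similarity up to scaling\<close>

text \<open>The scalar k accounts for the choice of a spanning matrix of a line. The intertwining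
  form avoids inverses, so concrete instances are polynomial identities.\<close>

definition proj_similar :: "real^3^3 \<Rightarrow> real^3^3 \<Rightarrow> bool" where
  "proj_similar A B \<longleftrightarrow> (\<exists>k P. k \<noteq> 0 \<and> det P \<noteq> 0 \<and> A ** P = k *\<^sub>R (P ** B))"

lemma proj_similarI:
  "k \<noteq> 0 \<Longrightarrow> det P \<noteq> 0 \<Longrightarrow> A ** P = k *\<^sub>R (P ** B) \<Longrightarrow> proj_similar A B"
  by (auto simp: proj_similar_def)

lemma scaleR_mult3:
  fixes A B :: "real^3^3"
  shows "(k *\<^sub>R A) ** B = k *\<^sub>R (A ** B)" "A ** (k *\<^sub>R B) = k *\<^sub>R (A ** B)"
  by (simp_all add: vec_eq_iff forall_3 matrix_matrix_mult_def sum_3 algebra_simps)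

lemma det_scaleR3: "det (k *\<^sub>R A) = k ^ 3 * det (A :: real^3^3)"
  by (simp add: det_3 algebra_simps power3_eq_cube)

lemma matrix_add_rdistrib3:
  fixes A B C :: "real^3^3"
  shows "(A + B) ** C = A ** C + B ** C"
  by (simp add: vec_eq_iff matrix_matrix_mult_def sum_3 algebra_simps)

lemma proj_similar_trans:
  assumes "proj_similar A B" "proj_similar B C"
  shows "proj_similar A C"
proof -
  obtain k P where P: "k \<noteq> 0" "det P \<noteq> 0" "A ** P = k *\<^sub>R (P ** B)"
    using assms(1) by (auto simp: proj_similar_def)
  obtain l Q where Q: "l \<noteq> 0" "det Q \<noteq> 0" "B ** Q = l *\<^sub>R (Q ** C)"
    using assms(2) by (auto simp: proj_similar_def)
  have "A ** (P ** Q) = k *\<^sub>R (P ** (B ** Q))"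
    by (metis P(3) matrix_mul_assoc scaleR_mult3(1))
  also have "\<dots> = (k * l) *\<^sub>R ((P ** Q) ** C)"
    by (simp add: Q(3) scaleR_mult3 matrix_mul_assoc)
  finally show ?thesis
    using P Q by (intro proj_similarI[of "k * l" "P ** Q"]) (auto simp: det_mul)
qed

lemma obtain_inverse3:
  fixes P :: "real^3^3"
  assumes "det P \<noteq> 0"
  obtains Q where "P ** Q = mat 1" "Q ** P = mat 1" "det Q = 1 / det P"
proof -
  obtain Q where Q: "P ** Q = mat 1" "Q ** P = mat 1"
    using assms invertible_det_nz[of P] by (auto simp: invertible_def)
  have "det P * det Q = 1"
    using Q(1) by (metis det_mul det_I)
  then show ?thesis
    using Q that assms by (simp add: field_simps)
qed

lemma proj_similar_sym:
  assumes "proj_similar A B"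
  shows "proj_similar B A"
proof -
  obtain k P where P: "k \<noteq> 0" "det P \<noteq> 0" "A ** P = k *\<^sub>R (P ** B)"
    using assms by (auto simp: proj_similar_def)
  obtain Q where Q: "P ** Q = mat 1" "Q ** P = mat 1" "det Q = 1 / det P"
    using obtain_inverse3[OF P(2)] .
  have "Q ** A = Q ** (A ** P) ** Q"
    by (metis Q(1) matrix_mul_assoc matrix_mul_rid)
  also have "\<dots> = k *\<^sub>R (B ** Q)"
    by (simp add: P(3) scaleR_mult3 matrix_mul_assoc Q(2))
  finally show ?thesis
    using P Q by (intro proj_similarI[of "1 / k" Q]) auto
qed

lemma matrix_inv_eqI:
  fixes P Q :: "real^3^3"
  assumes "P ** Q = mat 1" "Q ** P = mat 1"
  shows "matrix_inv P = Q"
proof -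
  have "P ** matrix_inv P = mat 1 \<and> matrix_inv P ** P = mat 1"
    unfolding matrix_inv_def by (rule someI[of _ Q]) (use assms in simp)
  then show ?thesis
    by (metis assms(2) matrix_mul_assoc matrix_mul_lid matrix_mul_rid)
qed

text \<open>A cube root of the determinant exists for either sign, so in odd dimension conjugation by
  the general linear group is no coarser than conjugation by the special one.\<close>

lemma conjugate_span_iff:
  assumes "A \<noteq> 0"
  shows "span {A} \<sim> span {B} \<longleftrightarrow> proj_similar A B"
proof
  assume "span {A} \<sim> span {B}"
  then obtain g where g: "det g = 1" and eq: "span {B} = conj_act g (span {A})"
    by (auto simp: conjugate_def SL3_def)
  obtain Q where Q: "g ** Q = mat 1" "Q ** g = mat 1" "det Q = 1 / det g"
    using obtain_inverse3[of g] g by auto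
  have inv: "matrix_inv g = Q"
    using Q by (intro matrix_inv_eqI)
  have "g ** A ** Q \<in> span {B}"
    unfolding eq conj_act_def inv by (rule imageI) (simp add: span_base)
  then obtain k where k: "g ** A ** Q = k *\<^sub>R B"
    by (auto simp: span_singleton)
  have *: "A ** Q = k *\<^sub>R (Q ** B)"
    by (metis (no_types, lifting) k Q(2) matrix_mul_assoc matrix_mul_lid scaleR_mult3(2))
  have "k \<noteq> 0"
  proof
    assume "k = 0"
    with * have "A ** Q ** g = 0 ** g" by simp
    then have "A = 0"
      by (metis Q(2) matrix_mul_assoc matrix_mul_rid scaleR_zero_left scaleR_mult3(1))
    with assms show False by simp
  qed
  with * Q(3) g show "proj_similar A B"
    by (intro proj_similarI[of k Q]) auto
next
  assume "proj_similar A B"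
  then obtain k P where P: "k \<noteq> 0" "det P \<noteq> 0" "A ** P = k *\<^sub>R (P ** B)"
    by (auto simp: proj_similar_def)
  define c where "c = root 3 (1 / det P)"
  have c: "c ^ 3 = 1 / det P"
    by (simp add: c_def odd_real_root_pow)
  define Q where "Q = c *\<^sub>R P"
  have detQ: "det Q = 1"
    using P by (simp add: Q_def det_scaleR3 c)
  have AQ: "A ** Q = k *\<^sub>R (Q ** B)"
    by (simp add: Q_def scaleR_mult3 P(3))
  \<comment> \<open>In \<open>conj_act\<close> the acting element stands on the left, so it is the
    inverse of the change of basis \<open>Q\<close>.\<close>
  obtain g where g: "Q ** g = mat 1" "g ** Q = mat 1" "det g = 1 / det Q"
    using obtain_inverse3[of Q] detQ by auto
  have inv: "matrix_inv g = Q"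
    using g by (intro matrix_inv_eqI)
  have gAQ: "g ** A ** Q = k *\<^sub>R B"
    by (metis AQ g(2) matrix_mul_assoc matrix_mul_lid scaleR_mult3(2))
  have "conj_act g (span {A}) = range (\<lambda>t. (t * k) *\<^sub>R B)"
    unfolding conj_act_def inv span_singleton image_image
    by (simp add: scaleR_mult3 gAQ)
  also have "\<dots> = span {B}"
    unfolding span_singleton
  proof safe
    fix t
    have "t *\<^sub>R B = (t / k * k) *\<^sub>R B" using P by simp
    then show "t *\<^sub>R B \<in> range (\<lambda>t. (t * k) *\<^sub>R B)" by blast
  qed auto
  finally show "span {A} \<sim> span {B}"
    using g detQ unfolding conjugate_def SL3_def by (intro bexI[of _ g]) auto
qed

section \<open>Invariants\<close>

text \<open>The minimal polynomial has degree at most two. This tells apart matrices with equal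
  characteristic polynomial: \<open>u11\<close> from \<open>u12\<close>, and \<open>u13\<close> from
  \<open>u14 2\<close>.\<close>

definition quadratic :: "real^3^3 \<Rightarrow> bool" where
  "quadratic A \<longleftrightarrow> (\<exists>p r. A ** A = p *\<^sub>R A + mat r)"

lemma trace_eq_if_intertwined:
  fixes A B P :: "real^3^3"
  assumes "A ** P = P ** B" "det P \<noteq> 0"
  shows "trace A = trace B"
proof -
  obtain Q where Q: "P ** Q = mat 1" "Q ** P = mat 1"
    using obtain_inverse3[OF assms(2)] by metis
  have "trace A = trace (P ** (B ** Q))"
    by (metis Q(1) assms(1) matrix_mul_assoc matrix_mul_rid)
  also have "\<dots> = trace B"
    by (metis Q(2) trace_mul_sym matrix_mul_assoc matrix_mul_rid)
  finally show ?thesis .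
qed

text \<open>Determinants of the intertwining relation give the factor k^3. Applying the relation
  twice intertwines A^2 with k^2 B^2, whence the traces.\<close>

lemma proj_similar_invariants:
  assumes "proj_similar A B"
  obtains k where "k \<noteq> 0" "det A = k ^ 3 * det B" "trace (A ** A) = k\<^sup>2 * trace (B ** B)"
proof -
  obtain k P where P: "k \<noteq> 0" "det P \<noteq> 0" "A ** P = k *\<^sub>R (P ** B)"
    using assms by (auto simp: proj_similar_def)
  have "det A * det P = k ^ 3 * (det P * det B)"
    by (metis P(3) det_mul det_scaleR3)
  then have d: "det A = k ^ 3 * det B"
    using P(2) by simp
  have "(A ** A) ** P = A ** (k *\<^sub>R (P ** B))"
    by (metis P(3) matrix_mul_assoc)
  also have "\<dots> = P ** ((k\<^sup>2) *\<^sub>R (B ** B))"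
    by (simp add: scaleR_mult3 matrix_mul_assoc P(3) power2_eq_square)
  finally have "trace (A ** A) = trace ((k\<^sup>2) *\<^sub>R (B ** B))"
    using P(2) trace_eq_if_intertwined by blast
  then have "trace (A ** A) = k\<^sup>2 * trace (B ** B)"
    by (simp add: trace_def sum_distrib_left)
  with P(1) d show ?thesis using that by blast
qed

text \<open>Cancelling P turns A^2 = p A + r into B^2 = (p/k) B + r/k^2.\<close>

lemma quadratic_proj_similar:
  assumes "proj_similar A B" "quadratic A"
  shows "quadratic B"
proof -
  obtain k P where P: "k \<noteq> 0" "det P \<noteq> 0" "A ** P = k *\<^sub>R (P ** B)"
    using assms(1) by (auto simp: proj_similar_def)
  obtain Q where Q: "P ** Q = mat 1" "Q ** P = mat 1"
    using obtain_inverse3[OF P(2)] by metis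
  obtain p r where pr: "A ** A = p *\<^sub>R A + mat r"
    using assms(2) by (auto simp: quadratic_def)
  have mat: "mat r = r *\<^sub>R (mat 1 :: real^3^3)"
    by (simp add: mat_eq_mat3)
  have "(A ** A) ** P = A ** (k *\<^sub>R (P ** B))"
    by (metis P(3) matrix_mul_assoc)
  also have "\<dots> = P ** ((k\<^sup>2) *\<^sub>R (B ** B))"
    by (simp add: scaleR_mult3 matrix_mul_assoc P(3) power2_eq_square)
  finally have 1: "(A ** A) ** P = P ** ((k\<^sup>2) *\<^sub>R (B ** B))" .
  have "(A ** A) ** P = P ** ((p * k) *\<^sub>R B + r *\<^sub>R mat 1)"
    unfolding pr mat by (simp add: matrix_add_rdistrib3 matrix_add_ldistrib scaleR_mult3 P(3))
  with 1 have "Q ** (P ** ((k\<^sup>2) *\<^sub>R (B ** B))) = Q ** (P ** ((p * k) *\<^sub>R B + r *\<^sub>R mat 1))"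
    by simp
  then have "(k\<^sup>2) *\<^sub>R (B ** B) = (p * k) *\<^sub>R B + r *\<^sub>R mat 1"
    unfolding matrix_mul_assoc Q(2) by simp
  then have "(1 / k\<^sup>2) *\<^sub>R ((k\<^sup>2) *\<^sub>R (B ** B)) = (1 / k\<^sup>2) *\<^sub>R ((p * k) *\<^sub>R B + r *\<^sub>R mat 1)"
    by simp
  then have "B ** B = (p / k) *\<^sub>R B + (r / k\<^sup>2) *\<^sub>R mat 1"
    using P(1) by (simp add: scaleR_add_right power2_eq_square)
  also have "(r / k\<^sup>2) *\<^sub>R mat 1 = (mat (r / k\<^sup>2) :: real^3^3)"
    by (simp add: mat_eq_mat3)
  finally show ?thesis
    by (auto simp: quadratic_def)
qed

text \<open>For a traceless matrix, \<open>trace (A\<^sup>2) ^ 3 - 54 * (det A)\<^sup>2\<close> is twice the discriminant of the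
  characteristic polynomial. The value is the index in \<^const>\<open>families\<close> of the family to which
  the line through \<open>A\<close> belongs.\<close>

definition family_index :: "real^3^3 \<Rightarrow> nat" where
  "family_index A =
    (let q = trace (A ** A); d = det A in
     if d = 0 then (if q = 0 then (if quadratic A then 1 else 0) else if q > 0 then 4 else 5)
     else if q ^ 3 < 54 * d\<^sup>2 then 6
     else if q ^ 3 = 54 * d\<^sup>2 \<and> \<not> quadratic A then 2 else 3)"

text \<open>Both q^3 and d^2 scale by the positive factor k^6, so their comparison survives; the
  sign of q and the vanishing of d survive as well.\<close>

lemma family_index_proj_similar:
  assumes "proj_similar A B"
  shows "family_index A = family_index B"
proof -
  have quad: "quadratic A \<longleftrightarrow> quadratic B"
    using assms proj_similar_sym quadratic_proj_similar by blast
  obtain k where k: "k \<noteq> 0" "det A = k ^ 3 * det B" "trace (A ** A) = k\<^sup>2 * trace (B ** B)"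
    using proj_similar_invariants[OF assms] .
  let ?q = "trace (B ** B)" and ?d = "det B"
  have pos: "k ^ 6 > 0" "k\<^sup>2 > 0"
    using k(1) by (simp_all add: zero_less_power_eq)
  have "(k\<^sup>2 * ?q) ^ 3 = k ^ 6 * ?q ^ 3" "54 * (k ^ 3 * ?d)\<^sup>2 = k ^ 6 * (54 * ?d\<^sup>2)"
    by (simp_all add: power_mult_distrib flip: power_mult)
  then have "(k\<^sup>2 * ?q) ^ 3 < 54 * (k ^ 3 * ?d)\<^sup>2 \<longleftrightarrow> ?q ^ 3 < 54 * ?d\<^sup>2"
    "(k\<^sup>2 * ?q) ^ 3 = 54 * (k ^ 3 * ?d)\<^sup>2 \<longleftrightarrow> ?q ^ 3 = 54 * ?d\<^sup>2"
    using pos(1) by (simp_all only: mult_less_cancel_left_pos mult_cancel_left) auto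
  moreover have "k\<^sup>2 * ?q > 0 \<longleftrightarrow> ?q > 0"
    using pos(2) by (simp add: zero_less_mult_iff)
  ultimately show ?thesis
    using k(1) unfolding family_index_def k quad Let_def by simp
qed

lemma quadratic_mat3_iff:
  "quadratic (mat3 a b c d e f g h i) \<longleftrightarrow>
     (\<exists>p r. mat3 a b c d e f g h i ** mat3 a b c d e f g h i =
        mat3 (p*a + r) (p*b) (p*c) (p*d) (p*e + r) (p*f) (p*g) (p*h) (p*i + r))"
  unfolding quadratic_def mat_eq_mat3 mat3_scaleR mat3_add by simp

text \<open>The discriminant is the square of the product of the eigenvalue differences. Where it
  vanishes, the matrix is diagonal with only two distinct eigenvalues, hence
  \<open>quadratic\<close>.\<close>

lemma family_index_diag:
  assumes "a \<noteq> 0" "a \<noteq> 1"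
  shows "family_index (mat3 1 0 0 0 (a - 1) 0 0 0 (- a)) = 3"
proof -
  let ?A = "mat3 1 0 0 0 (a - 1) 0 0 0 (- a)"
  let ?q = "trace (?A ** ?A)" and ?d = "det ?A"
  have d: "?d \<noteq> 0" using assms by simp
  have disc: "?q ^ 3 - 54 * ?d\<^sup>2 = 2 * ((a + 1) * (a - 2) * (2 * a - 1))\<^sup>2"
    by (simp add: power2_eq_square power3_eq_cube) algebra
  have "quadratic ?A" if "?q ^ 3 = 54 * ?d\<^sup>2"
  proof -
    \<comment> \<open>At a = -1 and a = 2 the eigenvalues are 1, 1, -2 and the minimal polynomial is
      (x - 1)(x + 2); at a = 1/2 it is (x - 1)(x + 1/2). The witnesses below are read off from
      these.\<close>
    have "a = -1 \<or> a = 2 \<or> a = 1/2" using that disc by auto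
    then show ?thesis
    proof (elim disjE)
      assume "a = -1" then show ?thesis unfolding quadratic_mat3_iff
        by (intro exI[of _ "-1"] exI[of _ 2]) simp
    next
      assume "a = 2" then show ?thesis unfolding quadratic_mat3_iff
        by (intro exI[of _ "-1"] exI[of _ 2]) simp
    next
      assume "a = 1/2" then show ?thesis unfolding quadratic_mat3_iff
        by (intro exI[of _ "1/2"] exI[of _ "1/2"]) (simp add: \<open>a = 1/2\<close>)
    qed
  qed
  moreover have "\<not> ?q ^ 3 < 54 * ?d\<^sup>2"
    using disc zero_le_power2[of "(a + 1) * (a - 2) * (2 * a - 1)"] by linarith
  ultimately show ?thesis
    using d unfolding family_index_def Let_def by auto
qed

text \<open>The eigenvalues are 1 and -1/2 \<plusminus> iy, so the discriminant is negative; the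
  explicit polynomial below is minus twice it.\<close>

lemma family_index_u17:
  assumes "y \<noteq> 0"
  shows "family_index (mat3 1 0 0 0 (-1/2) (-y) 0 y (-1/2)) = 6"
proof -
  let ?A = "mat3 1 0 0 0 (-1/2) (-y) 0 y (-1/2)"
  have q: "trace (?A ** ?A) = 3/2 - 2 * y\<^sup>2" and d: "det ?A = 1/4 + y\<^sup>2"
    by (simp_all add: power2_eq_square)
  have y: "y\<^sup>2 > 0" using assms by simp
  have "54 * (1/4 + y\<^sup>2)\<^sup>2 - (3/2 - 2 * y\<^sup>2) ^ 3 = y\<^sup>2 * (81/2 + 36 * y\<^sup>2 + 8 * (y\<^sup>2)\<^sup>2)"
    by (simp add: power2_eq_square power3_eq_cube algebra_simps)
  also have "\<dots> > 0"
    using y by (intro mult_pos_pos add_pos_nonneg) auto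
  finally have "(3/2 - 2 * y\<^sup>2) ^ 3 < 54 * (1/4 + y\<^sup>2)\<^sup>2" by simp
  moreover have "1/4 + y\<^sup>2 \<noteq> 0" using y by linarith
  ultimately show ?thesis
    unfolding family_index_def Let_def q d by simp
qed

lemma family_index_rep:
  assumes "i < length families" "U \<in> families ! i"
  obtains A where "U = span {A}" "A \<noteq> 0" "trace A = 0" "family_index A = i"
proof -
  have "i \<in> {0, 1, 2, 3, 4, 5, 6}"
    using assms(1) by (auto simp: families_def)
  then consider "i = 0" "U = u11" | "i = 1" "U = u12" | "i = 2" "U = u13"
    | a where "i = 3" "U = u14 a" "a \<noteq> 0" "a \<noteq> 1"
    | "i = 4" "U = u15" | "i = 5" "U = u16" | y where "i = 6" "U = u17 y" "y \<noteq> 0"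
    using assms(2) by (auto simp: families_def)
  then show ?thesis
  proof cases
    case 1 then show ?thesis
      by (intro that) (auto simp: u_eq_mat3 zero_eq_mat3 family_index_def quadratic_mat3_iff)
  next
    case 2 then show ?thesis
      by (intro that) (auto simp: u_eq_mat3 zero_eq_mat3 family_index_def quadratic_mat3_iff)
  next
    case 3 then show ?thesis
      by (intro that) (auto simp: u_eq_mat3 zero_eq_mat3 family_index_def quadratic_mat3_iff)
  next
    case 4 then show ?thesis
      by (intro that[OF _ _ _ family_index_diag[of a, folded 4(1)]]) (auto simp: u_eq_mat3 zero_eq_mat3)
  next
    case 5 then show ?thesis
      by (intro that) (auto simp: u_eq_mat3 zero_eq_mat3 family_index_def quadratic_mat3_iff)
  next
    case 6 then show ?thesis
      by (intro that) (auto simp: u_eq_mat3 zero_eq_mat3 family_index_def quadratic_mat3_iff)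
  next
    case 7 then show ?thesis
      by (intro that[OF _ _ _ family_index_u17[of y, folded 7(1)]]) (auto simp: u_eq_mat3 zero_eq_mat3)
  qed
qed

section \<open>Normal forms\<close>

text \<open>Stated through \<open>proj_similar\<close> so that successive changes of basis chain by
  \<open>listed_trans\<close>; normalising determinants is left to the end.\<close>

definition listed :: "real^3^3 \<Rightarrow> bool" where
  "listed A \<longleftrightarrow> (\<exists>B. proj_similar A B \<and> span {B} \<in> \<Union>(set families))"

lemma listed_trans: "proj_similar A B \<Longrightarrow> listed B \<Longrightarrow> listed A"
  using proj_similar_trans by (auto simp: listed_def)

lemma listedI:
  "k \<noteq> 0 \<Longrightarrow> det P \<noteq> 0 \<Longrightarrow> A ** P = k *\<^sub>R (P ** B) \<Longrightarrow> span {B} \<in> \<Union>(set families)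
     \<Longrightarrow> listed A"
  unfolding listed_def using proj_similarI by blast

lemma in_families:
  "u11 \<in> \<Union>(set families)" "u12 \<in> \<Union>(set families)" "u13 \<in> \<Union>(set families)"
  "a \<noteq> 0 \<Longrightarrow> a \<noteq> 1 \<Longrightarrow> u14 a \<in> \<Union>(set families)"
  "u15 \<in> \<Union>(set families)" "u16 \<in> \<Union>(set families)" "y \<noteq> 0 \<Longrightarrow> u17 y \<in> \<Union>(set families)"
proof -
  show "a \<noteq> 0 \<Longrightarrow> a \<noteq> 1 \<Longrightarrow> u14 a \<in> \<Union>(set families)"
    by (rule UnionI[of "{u14 a | a. a \<noteq> 0 \<and> a \<noteq> 1}"]) (simp add: families_def, blast)
  show "y \<noteq> 0 \<Longrightarrow> u17 y \<in> \<Union>(set families)"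
    by (rule UnionI[of "{u17 y | y. y \<noteq> 0}"]) (simp add: families_def, blast)
qed (simp_all add: families_def)

lemmas mat3_in_families = in_families[unfolded u_eq_mat3]

text \<open>If one eigenvalue is 0, the other two are opposite and a permutation leads to
  \<open>u15\<close>. Otherwise dividing by l leads to \<open>u14\<close>.\<close>

lemma listed_diag:
  assumes "l + m + n = 0" "l \<noteq> 0 \<or> m \<noteq> 0 \<or> n \<noteq> 0"
  shows "listed (mat3 l 0 0 0 m 0 0 0 n)"
proof -
  consider "l = 0" | "m = 0" | "n = 0" | "l \<noteq> 0" "m \<noteq> 0" "n \<noteq> 0" by blast
  then show ?thesis
  proof cases
    case 1
    with assms show ?thesis
      by (intro listedI[OF _ _ _ mat3_in_families(5), of m "mat3 0 1 0 1 0 0 0 0 1"]) auto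
  next
    case 2
    with assms show ?thesis
      by (intro listedI[OF _ _ _ mat3_in_families(5), of l "mat3 1 0 0 0 1 0 0 0 1"]) auto
  next
    case 3
    with assms show ?thesis
      by (intro listedI[OF _ _ _ mat3_in_families(5), of l "mat3 1 0 0 0 0 1 0 1 0"]) auto
  next
    case 4
    have m: "m = - l - n" using assms by simp
    \<comment> \<open>The parameter comes from matching diag(l, m, n) / l with diag(1, a - 1, -a).
      It avoids 0 and 1 because n and m are nonzero.\<close>
    have "- n / l \<noteq> 0" "- n / l \<noteq> 1"
      using 4 assms by (auto simp: field_simps)
    note mat3_in_families(4)[OF this]
    then show ?thesis
      by (rule listedI[of l "mat3 1 0 0 0 1 0 0 0 1", rotated -1])
        (use 4 in \<open>auto simp: m right_diff_distrib\<close>)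
  qed
qed

text \<open>After division by l, rescaling the first basis vector normalises a nonzero off-diagonal
  entry to 1.\<close>

lemma listed_jordan:
  assumes "l \<noteq> 0"
  shows "listed (mat3 l x 0 0 l 0 0 0 (- 2 * l))"
proof (cases "x = 0")
  case True
  then show ?thesis using listed_diag[of l l "-2 * l"] assms by simp
next
  case False
  then show ?thesis
    using assms
    by (intro listedI[OF _ _ _ mat3_in_families(3), of l "mat3 (x / l) 0 0 0 1 0 0 0 1"]) auto
qed

lemma listed_nilpotent:
  assumes "x \<noteq> 0 \<or> y \<noteq> 0 \<or> z \<noteq> 0"
  shows "listed (mat3 0 x y 0 0 z 0 0 0)"
proof -
  consider "x \<noteq> 0" "z \<noteq> 0" | "x \<noteq> 0" "z = 0" | "x = 0" "z \<noteq> 0" | "x = 0" "z = 0" "y \<noteq> 0"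
    using assms by blast
  then show ?thesis
  proof cases
    \<comment> \<open>Rank two: the columns of the witness are the Jordan chain A^2 e3, A e3,
      e3.\<close>
    case 1 then show ?thesis
      by (intro listedI[OF _ _ _ mat3_in_families(1), of 1 "mat3 (x * z) y 0 0 z 0 0 0 1"]) auto
  next
    \<comment> \<open>Rank one, here and in the next two cases: the columns are A v, v and a second
      kernel vector, with v = e2 here and v = e3 afterwards.\<close>
    case 2 then show ?thesis
      by (intro listedI[OF _ _ _ mat3_in_families(2), of 1 "mat3 x 0 0 0 1 y 0 0 (- x)"]) auto
  next
    case 3 then show ?thesis
      by (intro listedI[OF _ _ _ mat3_in_families(2), of 1 "mat3 y 0 1 z 0 0 0 1 0"]) auto
  next
    case 4 then show ?thesis
      by (intro listedI[OF _ _ _ mat3_in_families(2), of 1 "mat3 y 0 0 0 0 1 0 1 0"]) auto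
  qed
qed

text \<open>Entries linking distinct eigenvalues can be cleared by solving linear equations. Trace
  zero makes a triple eigenvalue 0 and a double one l come with -2 l.\<close>

lemma listed_upper_triangular:
  assumes tr: "l + m + n = 0" and nz: "mat3 l x y 0 m z 0 0 n \<noteq> 0"
  shows "listed (mat3 l x y 0 m z 0 0 n)"
proof -
  consider "l = m" "m = n" | "l = m" "m \<noteq> n" | "l \<noteq> m" "m = n" | "l \<noteq> m" "l = n"
    | "l \<noteq> m" "m \<noteq> n" "l \<noteq> n" by blast
  then show ?thesis
  proof cases
    case 1
    with tr nz show ?thesis
      using listed_nilpotent[of x y z] by (auto simp: zero_eq_mat3)
  next
    case 2
    \<comment> \<open>Chosen so that (t, r, 1) is an eigenvector for n.\<close>
    define r where "r = z / (n - l)"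
    define t where "t = (x * r + y) / (n - l)"
    have "(n - l) * r = z" "(n - l) * t = x * r + y"
      using 2 by (simp_all add: r_def t_def)
    then have r: "l * r + z = n * r" and t: "l * t + x * r + y = n * t"
      by (simp_all add: left_diff_distrib)
    have n: "n = - 2 * l" using tr 2 by simp
    have "proj_similar (mat3 l x y 0 m z 0 0 n) (mat3 l x 0 0 l 0 0 0 n)"
      by (rule proj_similarI[of 1 "mat3 1 0 t 0 1 r 0 0 1"]) (use 2 r t in \<open>auto simp: algebra_simps\<close>)
    then show ?thesis
      using listed_trans listed_jordan[of l x] 2 n by (metis mult_zero_right)
  next
    case 3
    \<comment> \<open>The vector (s, 1, 0) is an eigenvector for m, and A sends (t, 0, 1) to m times
      itself plus z times (s, 1, 0). The eigenvector e1 for l is moved to the last place.\<close>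
    define s where "s = x / (m - l)"
    define t where "t = (y - s * z) / (m - l)"
    have "(m - l) * s = x" "(m - l) * t = y - s * z"
      using 3 by (simp_all add: s_def t_def)
    then have s: "l * s + x = m * s" and t: "l * t + y = s * z + m * t"
      by (simp_all add: left_diff_distrib)
    have l: "l = - 2 * m" using tr 3 by simp
    have "proj_similar (mat3 l x y 0 m z 0 0 n) (mat3 m z 0 0 m 0 0 0 l)"
      by (rule proj_similarI[of 1 "mat3 s t 1 1 0 0 0 1 0"]) (use 3 s t in \<open>auto simp: algebra_simps\<close>)
    then show ?thesis
      using listed_trans listed_jordan[of m z] 3 l by (metis mult_zero_right)
  next
    case 4
    \<comment> \<open>The vector (s, 1, 0) is an eigenvector for m and goes last; (0, r, 1)
      completes e1 to a basis of the generalised eigenspace of l.\<close>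
    define s where "s = x / (m - l)"
    define r where "r = z / (l - m)"
    have "(m - l) * s = x" "(l - m) * r = z"
      using 4 by (simp_all add: s_def r_def)
    then have s: "l * s + x = m * s" and r: "m * r + z = l * r"
      by (simp_all add: left_diff_distrib)
    have m: "m = - 2 * l" using tr 4 by simp
    have "proj_similar (mat3 l x y 0 m z 0 0 n) (mat3 l (y + x * r) 0 0 l 0 0 0 m)"
      by (rule proj_similarI[of 1 "mat3 1 0 s 0 r 1 0 1 0"]) (use 4 s r in \<open>auto simp: algebra_simps\<close>)
    then show ?thesis
      using listed_trans listed_jordan[of l "y + x * r"] 4 m by (metis mult_zero_right)
  next
    case 5
    \<comment> \<open>The eigenvectors for l, m, n are e1, (s, 1, 0) and (t, r, 1).\<close>
    define s where "s = x / (m - l)"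
    define r where "r = z / (n - m)"
    define t where "t = (x * r + y) / (n - l)"
    have "(m - l) * s = x" "(n - m) * r = z" "(n - l) * t = x * r + y"
      using 5 by (simp_all add: s_def r_def t_def)
    then have s: "l * s + x = m * s" and r: "m * r + z = n * r" and t: "l * t + x * r + y = n * t"
      by (simp_all add: left_diff_distrib)
    have "proj_similar (mat3 l x y 0 m z 0 0 n) (mat3 l 0 0 0 m 0 0 0 n)"
      by (rule proj_similarI[of 1 "mat3 1 s t 0 1 r 0 0 1"]) (use s r t in \<open>auto simp: algebra_simps\<close>)
    then show ?thesis
      using listed_trans listed_diag[of l m n] 5 tr by metis
  qed
qed

text \<open>For p = 0 a cyclic permutation puts the kernel in the middle, as in \<open>u16\<close>.
  Otherwise division by -2 p makes the real eigenvalue 1.\<close>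

lemma listed_rotation:
  assumes "q \<noteq> 0"
  shows "listed (mat3 (- 2 * p) 0 0 0 p (- q) 0 q p)"
proof (cases "p = 0")
  case True
  then show ?thesis
    using assms
    by (intro listedI[OF _ _ _ mat3_in_families(6), of q "mat3 0 1 0 0 0 1 1 0 0"]) auto
next
  case False
  have "- q / (2 * p) \<noteq> 0" using False assms by simp
  note mat3_in_families(7)[OF this]
  then show ?thesis
    by (rule listedI[of "- 2 * p" "mat3 1 0 0 0 1 0 0 0 1", rotated -1]) (use False in auto)
qed

text \<open>The discriminant \<open>D\<close> of the lower right block decides: a real eigenvalue of
  the block allows triangularisation, a non-real pair yields a scaled rotation.\<close>

lemma listed_block:
  assumes tr: "l + d + g = 0" and nz: "mat3 l b c 0 d e 0 f g \<noteq> 0"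
  shows "listed (mat3 l b c 0 d e 0 f g)"
proof -
  define D where "D = (d - g)\<^sup>2 + 4 * e * f"
  consider "f = 0" | "f \<noteq> 0" "D \<ge> 0" | "D < 0" by fastforce
  then show ?thesis
  proof cases
    case 1
    then show ?thesis using listed_upper_triangular[OF tr] nz by simp
  next
    case 2
    \<comment> \<open>An eigenvalue of the block, with eigenvector (m - g, f); this becomes the
      middle column of the change of basis.\<close>
    define m where "m = (d + g + sqrt D) / 2"
    have "(sqrt D)\<^sup>2 = D" using 2 by simp
    then have "(2 * m - (d + g))\<^sup>2 = (d - g)\<^sup>2 + 4 * e * f"
      by (simp add: m_def D_def add_divide_distrib)
    then have m: "d * (m - g) + e * f = m * (m - g)"
      by (simp add: power2_eq_square algebra_simps)
    let ?T = "mat3 l (b * (m - g) + c * f) b 0 m 1 0 0 (d + g - m)"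
    have "proj_similar (mat3 l b c 0 d e 0 f g) ?T"
      by (rule proj_similarI[of 1 "mat3 1 0 0 0 (m - g) 1 0 f 0"])
        (use 2 m in \<open>auto simp: algebra_simps\<close>)
    moreover have "listed ?T"
      using tr by (intro listed_upper_triangular) (auto simp: zero_eq_mat3)
    ultimately show ?thesis by (rule listed_trans)
  next
    case 3
    \<comment> \<open>The eigenvalues of the block are p \<plusminus> iq.\<close>
    define p where "p = (d + g) / 2"
    define q where "q = sqrt (- D) / 2"
    have q: "q \<noteq> 0" and f: "f \<noteq> 0"
      using 3 by (auto simp: q_def D_def)
    have "q\<^sup>2 = - D / 4"
      using 3 by (simp add: q_def power_divide)
    then have q2: "(d - p)\<^sup>2 + e * f = - q\<^sup>2"
      by (simp add: D_def p_def power2_eq_square field_simps)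
    have g: "g = 2 * p - d" and l: "l = - 2 * p"
      using tr by (simp_all add: p_def field_simps)
    \<comment> \<open>The third new basis vector is (M e - p e) / q, where M is the block and e its
      first unit vector; \<open>c'\<close> is the resulting corner entry.\<close>
    define c' where "c' = (b * (d - p) + c * f) / q"
    have "proj_similar (mat3 l b c 0 d e 0 f g) (mat3 l b c' 0 p (- q) 0 q p)"
      by (rule proj_similarI[of 1 "mat3 1 0 0 0 1 ((d - p) / q) 0 0 (f / q)"])
        (use q f q2 in \<open>auto simp: g c'_def field_simps power2_eq_square\<close>)
    moreover
    \<comment> \<open>Clearing the first row means solving a 2x2 linear system for s and t. Its
      determinant \<open>N\<close> is positive because the real l differs from p \<plusminus> iq; s
      and t come from Cramer's rule.\<close>
    define N where "N = (l - p)\<^sup>2 + q\<^sup>2"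
    define s where "s = (- b * (l - p) - c' * q) / N"
    define t where "t = (- c' * (l - p) + b * q) / N"
    have "N > 0"
      using q by (simp add: N_def add_nonneg_pos)
    then have "N * s = - b * (l - p) - c' * q" "N * t = - c' * (l - p) + b * q"
      by (simp_all add: s_def t_def)
    then have "N * (l * s + b) = N * (p * s + q * t)" "N * (l * t + c') = N * (p * t - q * s)"
      unfolding N_def by algebra+
    then have st: "l * s + b = p * s + q * t" "l * t + c' = p * t - q * s"
      using \<open>N > 0\<close> by simp_all
    have "proj_similar (mat3 l b c' 0 p (- q) 0 q p) (mat3 l 0 0 0 p (- q) 0 q p)"
      by (rule proj_similarI[of 1 "mat3 1 s t 0 1 0 0 0 1"]) (use st in \<open>auto simp: algebra_simps\<close>)
    ultimately show ?thesis
      using listed_rotation[OF q, of p] l listed_trans by metis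
  qed
qed

section \<open>Real eigenvectors and reduction to block form\<close>

text \<open>At \<open>M\<close> the odd cubic on the left is at least |d|, at \<open>- M\<close> at
  most -|d|; the intermediate value theorem applies.\<close>

lemma depressed_cubic_root:
  fixes s d :: real
  obtains t where "t ^ 3 + s * t = d"
proof -
  define M where "M = 1 + \<bar>s\<bar> + \<bar>d\<bar>"
  have M: "M \<ge> 1" by (simp add: M_def)
  have "M\<^sup>2 \<ge> M" using M by (simp add: power2_eq_square)
  then have "M\<^sup>2 + s \<ge> 1 + \<bar>d\<bar>" by (simp add: M_def)
  then have "M * (M\<^sup>2 + s) \<ge> M * (1 + \<bar>d\<bar>)" using M by simp
  moreover have "M * (1 + \<bar>d\<bar>) \<ge> 1 * (1 + \<bar>d\<bar>)" using M by (rule mult_right_mono) simp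
  ultimately have "M ^ 3 + s * M \<ge> \<bar>d\<bar>"
    by (simp add: power2_eq_square power3_eq_cube algebra_simps)
  then have "(- M) ^ 3 + s * (- M) \<le> d" "d \<le> M ^ 3 + s * M"
    by (simp_all add: power3_eq_cube)
  then show ?thesis
    using IVT'[of "\<lambda>t. t ^ 3 + s * t" "- M" d M] M that
    by (force intro!: continuous_intros)
qed

text \<open>Trace zero removes the quadratic term of the characteristic polynomial; its linear
  coefficient is the sum of the principal 2x2 minors.\<close>

lemma real_eigenvector:
  fixes A :: "real^3^3"
  assumes "trace A = 0"
  obtains t v where "v \<noteq> 0" "A *v v = t *\<^sub>R v"
proof -
  obtain a b c d e f g h i where A: "A = mat3 a b c d e f g h i"
    by (rule mat3_cases)
  have i: "i = - a - e" using assms A by simp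
  obtain t where t: "t ^ 3 + (a*e + a*i + e*i - b*d - c*g - f*h) * t = det A"
    by (rule depressed_cubic_root)
  have "det (A - mat t) = 0"
    using t by (simp add: A mat_eq_mat3 i power3_eq_cube algebra_simps)
  then have "\<not> invertible (A - mat t)"
    by (simp add: invertible_det_nz)
  then obtain v where v: "v \<noteq> 0" "(A - mat t) *v v = 0"
    by (metis invertible_left_inverse matrix_left_invertible_ker)
  have "mat t *v v = t *\<^sub>R v"
    by (simp add: vec_eq_iff forall_3 mat_eq_mat3 matrix_vector_mult_def sum_3)
  with v that show ?thesis
    by (simp add: matrix_vector_mult_diff_rdistrib)
qed

text \<open>In a basis that starts with a real eigenvector the first column becomes (t, 0, 0), so
  \<open>listed_block\<close> applies.\<close>

lemma listed_traceless:
  fixes A :: "real^3^3"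
  assumes "trace A = 0" "A \<noteq> 0"
  shows "listed A"
proof -
  obtain t v where v: "v \<noteq> 0" "A *v v = t *\<^sub>R v"
    using real_eigenvector[OF assms(1)] .
  obtain a b c d e f g h i where A: "A = mat3 a b c d e f g h i"
    by (rule mat3_cases)
  define x y z where "x = v $ 1" and "y = v $ 2" and "z = v $ 3"
  have eig: "a * x + b * y + c * z = t * x" "d * x + e * y + f * z = t * y"
    "g * x + h * y + i * z = t * z"
    using v(2) unfolding x_def y_def z_def
    by (simp_all add: vec_eq_iff forall_3 A matrix_vector_mult_def sum_3)
  have "\<exists>P :: real^3^3. det P \<noteq> 0 \<and> P $ 1 $ 1 = x \<and> P $ 2 $ 1 = y \<and> P $ 3 $ 1 = z"
  proof -
    \<comment> \<open>A nonzero coordinate of the eigenvector lets two unit vectors complete it to a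
      basis.\<close>
    consider "x \<noteq> 0" | "y \<noteq> 0" | "z \<noteq> 0"
      using v(1) by (auto simp: x_def y_def z_def vec_eq_iff forall_3)
    then show ?thesis
    proof cases
      case 1 then show ?thesis by (intro exI[of _ "mat3 x 0 0 y 1 0 z 0 1"]) simp
    next
      case 2 then show ?thesis by (intro exI[of _ "mat3 x 1 0 y 0 0 z 0 1"]) simp
    next
      case 3 then show ?thesis by (intro exI[of _ "mat3 x 1 0 y 0 1 z 0 0"]) simp
    qed
  qed
  then obtain P :: "real^3^3" where P: "det P \<noteq> 0" "P $ 1 $ 1 = x" "P $ 2 $ 1 = y" "P $ 3 $ 1 = z"
    by blast
  obtain Q where Q: "P ** Q = mat 1" "Q ** P = mat 1"
    using obtain_inverse3[OF P(1)] by metis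
  define B where "B = Q ** (A ** P)"
  have PB: "A ** P = P ** B"
    by (simp add: B_def matrix_mul_assoc Q(1))
  have col: "(Q ** X) $ r $ 1 = Q $ r $ 1 * X $ 1 $ 1 + Q $ r $ 2 * X $ 2 $ 1 + Q $ r $ 3 * X $ 3 $ 1"
    for X :: "real^3^3" and r
    by (simp add: matrix_matrix_mult_def sum_3)
  have "\<forall>r. (A ** P) $ r $ 1 = t * P $ r $ 1"
    using eig P unfolding forall_3 by (simp add: A matrix_matrix_mult_def sum_3)
  then have "B $ r $ 1 = t * (Q ** P) $ r $ 1" for r
    by (simp add: B_def col algebra_simps)
  then have B: "B $ 1 $ 1 = t" "B $ 2 $ 1 = 0" "B $ 3 $ 1 = 0"
    by (simp_all add: Q(2) mat_eq_mat3)
  have "trace B = 0"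
    using trace_eq_if_intertwined[OF PB P(1)] assms(1) by simp
  moreover have "B \<noteq> 0"
  proof
    assume "B = 0"
    then have "A ** P ** Q = 0 ** Q"
      using PB by (simp add: matrix_matrix_mult_def zero_vec_def)
    then show False
      using assms(2) by (simp add: Q(1) flip: matrix_mul_assoc)
  qed
  moreover have B_eq: "B = mat3 t (B$1$2) (B$1$3) 0 (B$2$2) (B$2$3) 0 (B$3$2) (B$3$3)"
    using mat3_collapse[of B] B by simp
  moreover have "t + B$2$2 + B$3$3 = trace B"
    using B by (simp add: trace_def sum_3)
  ultimately have "listed B"
    using listed_block[of t "B$2$2" "B$3$3" "B$1$2" "B$1$3" "B$2$3" "B$3$2"] by simp
  moreover have "proj_similar A B"
    using P(1) PB by (intro proj_similarI[of 1 P]) auto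
  ultimately show ?thesis using listed_trans by blast
qed

section \<open>Lines and the parametrised families\<close>

text \<open>Multiples of one matrix commute, so every line is closed under the bracket.\<close>

lemma lie_subalgebra_line:
  assumes "trace A = 0" "A \<noteq> 0"
  shows "lie_subalgebra_sl3 (span {A})" "dim (span {A}) = 1"
proof -
  have "trace (c *\<^sub>R A) = 0" for c
    using assms(1) by (simp add: trace_def flip: sum_distrib_left)
  moreover have "lie_bracket (c *\<^sub>R A) (c' *\<^sub>R A) = 0" for c c'
    by (simp add: lie_bracket_def scaleR_mult3 mult.commute)
  ultimately show "lie_subalgebra_sl3 (span {A})"
    unfolding lie_subalgebra_sl3_def
    by (auto simp: sl3_def span_singleton intro!: range_eqI[of _ _ 0] subspace_span)
       (metis span_singleton subspace_span)
  show "dim (span {A}) = 1"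
    using assms(2) by (simp add: dim_insert)
qed

lemma line_subalgebra_rep:
  assumes "lie_subalgebra_sl3 U" "dim U = 1"
  obtains A where "U = span {A}" "A \<noteq> 0" "trace A = 0"
proof -
  have U: "subspace U" "U \<subseteq> sl3"
    using assms(1) by (auto simp: lie_subalgebra_sl3_def)
  obtain B where B: "B \<subseteq> U" "independent B" "U \<subseteq> span B" "card B = 1"
    using basis_exists[of U] assms(2) by metis
  then obtain A where A: "B = {A}" by (auto simp: card_1_singleton_iff)
  have "U = span {A}"
    using B U A span_minimal by blast
  moreover have "A \<noteq> 0"
    using B(2) A by auto
  moreover have "trace A = 0"
    using B(1) U(2) A by (auto simp: sl3_def)
  ultimately show ?thesis using that by blast
qed

section \<open>Conjugacy within the two parametrised families\<close>

text \<open>Necessity: eliminating k from the invariants leaves an equation that splits into six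
  factors linear in b. Sufficiency: the six values correspond to the orderings of the eigenvalues 1,
  a - 1, -a.\<close>

lemma u14_conjugate_iff:
  assumes "a \<noteq> 0" "a \<noteq> 1" "b \<noteq> 0" "b \<noteq> 1"
  shows "u14 a \<sim> u14 b \<longleftrightarrow> b \<in> {a, 1 - a, 1 / a, 1 / (1 - a), a / (a - 1), (a - 1) / a}"
    (is "_ \<longleftrightarrow> b \<in> ?S")
proof -
  let ?D = "\<lambda>a. mat3 1 0 0 0 (a - 1) 0 0 0 (- a)"
  have "?D a \<noteq> 0" by (simp add: zero_eq_mat3)
  then have *: "u14 a \<sim> u14 b \<longleftrightarrow> proj_similar (?D a) (?D b)"
    by (simp add: u_eq_mat3 conjugate_span_iff)
  show ?thesis
  proof
    assume "u14 a \<sim> u14 b"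
    then obtain k where k: "k \<noteq> 0" "det (?D a) = k ^ 3 * det (?D b)"
      "trace (?D a ** ?D a) = k\<^sup>2 * trace (?D b ** ?D b)"
      using * proj_similar_invariants by blast
    have d: "a * (1 - a) = k ^ 3 * (b * (1 - b))"
      using k(2) by (simp add: algebra_simps)
    have q: "a\<^sup>2 - a + 1 = k\<^sup>2 * (b\<^sup>2 - b + 1)"
      using k(3) by (simp add: algebra_simps power2_eq_square)
    \<comment> \<open>After substitution both sides carry the same factor k^6.\<close>
    have "(a\<^sup>2 - a + 1) ^ 3 * (b * (1 - b))\<^sup>2 = (b\<^sup>2 - b + 1) ^ 3 * (a * (1 - a))\<^sup>2"
      unfolding d q by (simp add: power_mult_distrib flip: power_mult)
    moreover have "(a\<^sup>2 - a + 1) ^ 3 * (b * (1 - b))\<^sup>2 - (b\<^sup>2 - b + 1) ^ 3 * (a * (1 - a))\<^sup>2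
      = (b - a) * (b - (1 - a)) * (a * b - 1) * ((1 - a) * b - 1) * ((a - 1) * b - a) * (a * b - (a - 1))"
      by algebra
    ultimately have "b - a = 0 \<or> b - (1 - a) = 0 \<or> a * b - 1 = 0 \<or> (1 - a) * b - 1 = 0
        \<or> (a - 1) * b - a = 0 \<or> a * b - (a - 1) = 0"
      by auto
    then show "b \<in> ?S"
      using assms by (auto simp: field_simps)
  next
    assume "b \<in> ?S"
    \<comment> \<open>In each case the witness is a permutation matrix and k is the eigenvalue moved
      to the first place.\<close>
    then consider "b = a" | "b = 1 - a" | "b = 1 / a" | "b = 1 / (1 - a)" | "b = a / (a - 1)"
      | "b = (a - 1) / a" by blast
    then have "proj_similar (?D a) (?D b)"
    proof cases
      case 1 then show ?thesis
        by (intro proj_similarI[of 1 "mat3 1 0 0 0 1 0 0 0 1"]) auto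
    next
      case 2 then show ?thesis
        by (intro proj_similarI[of 1 "mat3 1 0 0 0 0 1 0 1 0"]) auto
    next
      case 3 with assms show ?thesis
        by (intro proj_similarI[of "- a" "mat3 0 0 1 0 1 0 1 0 0"]) (auto simp: field_simps)
    next
      case 4 with assms show ?thesis
        by (intro proj_similarI[of "a - 1" "mat3 0 0 1 1 0 0 0 1 0"]) (auto simp: field_simps)
    next
      case 5 with assms show ?thesis
        by (intro proj_similarI[of "a - 1" "mat3 0 1 0 1 0 0 0 0 1"]) (auto simp: field_simps)
    next
      case 6 with assms show ?thesis
        by (intro proj_similarI[of "- a" "mat3 0 1 0 0 0 1 1 0 0"]) (auto simp: field_simps)
    qed
    then show "u14 a \<sim> u14 b" using * by simp
  qed
qed

text \<open>Of the other five values two exceed 1, two are negative, and 1 - a lies in the interval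
  only for a = 1/2, where it equals a.\<close>

lemma u14_conjugate_fundamental_iff:
  assumes a: "a \<in> {1/2..<1}" and b: "b \<in> {1/2..<1}"
  shows "u14 a \<sim> u14 b \<longleftrightarrow> a = b"
proof -
  have "b = a" if "b \<in> {a, 1 - a, 1 / a, 1 / (1 - a), a / (a - 1), (a - 1) / a}"
  proof -
    have "1 / a > 1" "1 / (1 - a) > 1" "a / (a - 1) < 0" "(a - 1) / a < 0"
      using a by (auto simp: field_simps)
    with that a b show ?thesis by auto
  qed
  then show ?thesis
    using u14_conjugate_iff[of a b] a b by auto
qed

text \<open>The points -1, 0, 1/2, 1, 2 cut the line into six intervals, each carried into [1/2, 1)
  by one of the six maps.\<close>

lemma u14_fundamental_rep:
  assumes "c \<noteq> 0" "c \<noteq> 1"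
  shows "\<exists>a\<in>{1/2..<1}. u14 c \<sim> u14 a"
proof -
  let ?S = "{c, 1 - c, 1 / c, 1 / (1 - c), c / (c - 1), (c - 1) / c}"
  consider "c < -1" | "-1 \<le> c" "c < 0" | "0 < c" "c < 1/2" | "1/2 \<le> c" "c < 1" | "1 < c" "c \<le> 2"
    | "2 < c"
    using assms by linarith
  then have "\<exists>a\<in>{1/2..<1}. a \<in> ?S"
  proof cases
    case 1 then have "c / (c - 1) \<in> {1/2..<1}" by (auto simp: field_simps)
    then show ?thesis by blast
  next
    case 2 then have "1 / (1 - c) \<in> {1/2..<1}" by (auto simp: field_simps)
    then show ?thesis by blast
  next
    case 3 then have "1 - c \<in> {1/2..<1}" by auto
    then show ?thesis by blast
  next
    case 4 then have "c \<in> {1/2..<1}" by auto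
    then show ?thesis by blast
  next
    case 5 then have "1 / c \<in> {1/2..<1}" by (auto simp: field_simps)
    then show ?thesis by blast
  next
    case 6 then have "(c - 1) / c \<in> {1/2..<1}" by (auto simp: field_simps)
    then show ?thesis by blast
  qed
  then obtain a where a: "a \<in> {1/2..<1}" "a \<in> ?S" by blast
  then have "u14 c \<sim> u14 a"
    using u14_conjugate_iff[of c a] assms by auto
  with a show ?thesis by blast
qed

text \<open>The invariants force k = 1, and then the determinant fixes y^2. Conversely, reversing
  the third basis vector changes the sign of y.\<close>

lemma u17_conjugate_iff:
  assumes "y \<noteq> 0" "y' \<noteq> 0"
  shows "u17 y \<sim> u17 y' \<longleftrightarrow> y = y' \<or> y = - y'"
proof -
  let ?R = "\<lambda>y. mat3 1 0 0 0 (-1/2) (-y) 0 y (-1/2)"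
  have "?R y \<noteq> 0" by (simp add: zero_eq_mat3)
  then have *: "u17 y \<sim> u17 y' \<longleftrightarrow> proj_similar (?R y) (?R y')"
    by (simp add: u_eq_mat3 conjugate_span_iff)
  show ?thesis
  proof
    assume "u17 y \<sim> u17 y'"
    then obtain k where k: "k \<noteq> 0" "det (?R y) = k ^ 3 * det (?R y')"
      "trace (?R y ** ?R y) = k\<^sup>2 * trace (?R y' ** ?R y')"
      using * proj_similar_invariants by blast
    define d where "d = 1/4 + y'\<^sup>2"
    have d1: "1/4 + y\<^sup>2 = k ^ 3 * d"
      using k(2) by (simp add: d_def power2_eq_square)
    have q1: "3/2 - 2 * y\<^sup>2 = k\<^sup>2 * (2 - 2 * d)"
      using k(3) by (simp add: d_def power2_eq_square algebra_simps)
    text \<open>The real eigenvalue is normalised to 1, so \<open>trace (A\<^sup>2) + 2 * det A = 2\<close> on this family.\<close>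
    have "(k - 1) * (k + 1 + d * k\<^sup>2) = 0"
      using d1 q1 by (simp add: algebra_simps power2_eq_square power3_eq_cube)
    \<comment> \<open>Since d > 1/4, the quadratic d k^2 + k + 1 has negative discriminant;
      comparison with the square (k/2 + 1)^2 shows that it is positive.\<close>
    moreover have "d * k\<^sup>2 > 1/4 * k\<^sup>2"
      using k(1) assms by (simp add: d_def)
    then have "k + 1 + d * k\<^sup>2 > (k / 2 + 1)\<^sup>2"
      by (simp add: power2_eq_square algebra_simps)
    then have "k + 1 + d * k\<^sup>2 > 0"
      using zero_le_power2[of "k / 2 + 1"] by linarith
    ultimately have "k = 1" by simp
    then have "y\<^sup>2 = y'\<^sup>2" using d1 by (simp add: d_def)
    then show "y = y' \<or> y = - y'" by (simp add: power2_eq_iff)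
  next
    assume "y = y' \<or> y = - y'"
    then have "proj_similar (?R y) (?R y')"
    proof
      assume "y = y'" then show ?thesis
        by (intro proj_similarI[of 1 "mat3 1 0 0 0 1 0 0 0 1"]) auto
    next
      assume "y = - y'" then show ?thesis
        by (intro proj_similarI[of 1 "mat3 1 0 0 0 1 0 0 0 (-1)"]) auto
    qed
    then show "u17 y \<sim> u17 y'" using * by simp
  qed
qed

theorem theorem5p1:
  shows "(\<forall>F\<in>set families. \<forall>U\<in>F. lie_subalgebra_sl3 U \<and> dim U = 1)
    \<and> (\<forall>U. lie_subalgebra_sl3 U \<and> dim U = 1 \<longrightarrow> (\<exists>F\<in>set families. \<exists>V\<in>F. U \<sim> V))
    \<and> (\<forall>i<length families. \<forall>j<length families. i \<noteq> j \<longrightarrow>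
         (\<forall>U\<in>families ! i. \<forall>V\<in>families ! j. \<not> U \<sim> V))
    \<and> (\<forall>a b. a \<noteq> 0 \<and> a \<noteq> 1 \<and> b \<noteq> 0 \<and> b \<noteq> 1 \<longrightarrow>
         (u14 a \<sim> u14 b \<longleftrightarrow> b \<in> {a, 1 - a, 1 / a, 1 / (1 - a), a / (a - 1), (a - 1) / a}))
    \<and> (\<forall>a\<in>{1/2..<1}. \<forall>b\<in>{1/2..<1}. u14 a \<sim> u14 b \<longleftrightarrow> a = b)
    \<and> (\<forall>c. c \<noteq> 0 \<and> c \<noteq> 1 \<longrightarrow> (\<exists>a\<in>{1/2..<1}. u14 c \<sim> u14 a))
    \<and> (\<forall>y y'. y \<noteq> 0 \<and> y' \<noteq> 0 \<longrightarrow> (u17 y \<sim> u17 y' \<longleftrightarrow> y = y' \<or> y = - y'))"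
proof (intro conjI)
  show "\<forall>F\<in>set families. \<forall>U\<in>F. lie_subalgebra_sl3 U \<and> dim U = 1"
    by (metis in_set_conv_nth family_index_rep lie_subalgebra_line)
  show "\<forall>U. lie_subalgebra_sl3 U \<and> dim U = 1 \<longrightarrow> (\<exists>F\<in>set families. \<exists>V\<in>F. U \<sim> V)"
  proof (intro allI impI, elim conjE)
    fix U assume "lie_subalgebra_sl3 U" "dim U = 1"
    then obtain A where A: "U = span {A}" "A \<noteq> 0" "trace A = 0"
      by (rule line_subalgebra_rep)
    then obtain B where "proj_similar A B" "span {B} \<in> \<Union>(set families)"
      using listed_traceless unfolding listed_def by blast
    then show "\<exists>F\<in>set families. \<exists>V\<in>F. U \<sim> V"
      using A conjugate_span_iff by blast
  qed
  show "\<forall>i<length families. \<forall>j<length families. i \<noteq> j \<longrightarrow>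
         (\<forall>U\<in>families ! i. \<forall>V\<in>families ! j. \<not> U \<sim> V)"
  proof (intro allI impI ballI notI)
    fix i j U V
    assume ij: "i < length families" "j < length families" "i \<noteq> j"
      and UV: "U \<in> families ! i" "V \<in> families ! j" "U \<sim> V"
    obtain A where A: "U = span {A}" "A \<noteq> 0" "family_index A = i"
      using family_index_rep[OF ij(1) UV(1)] by metis
    obtain B where B: "V = span {B}" "family_index B = j"
      using family_index_rep[OF ij(2) UV(2)] by metis
    show False
      using family_index_proj_similar[of A B] conjugate_span_iff[of A B] A B UV(3) ij(3) by simp
  qed
  show "\<forall>a b. a \<noteq> 0 \<and> a \<noteq> 1 \<and> b \<noteq> 0 \<and> b \<noteq> 1 \<longrightarrow>
         (u14 a \<sim> u14 b \<longleftrightarrow> b \<in> {a, 1 - a, 1 / a, 1 / (1 - a), a / (a - 1), (a - 1) / a})"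
    by (intro allI impI, elim conjE, rule u14_conjugate_iff)
  show "\<forall>a\<in>{1/2..<1}. \<forall>b\<in>{1/2..<1}. u14 a \<sim> u14 b \<longleftrightarrow> a = b"
    by (intro ballI, rule u14_conjugate_fundamental_iff)
  show "\<forall>c. c \<noteq> 0 \<and> c \<noteq> 1 \<longrightarrow> (\<exists>a\<in>{1/2..<1}. u14 c \<sim> u14 a)"
    by (intro allI impI, elim conjE, rule u14_fundamental_rep)
  show "\<forall>y y'. y \<noteq> 0 \<and> y' \<noteq> 0 \<longrightarrow> (u17 y \<sim> u17 y' \<longleftrightarrow> y = y' \<or> y = - y')"
    by (intro allI impI, elim conjE, rule u17_conjugate_iff)
qed

end
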